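(* Let $\alpha=\log(1/h)$ and let $c>0$ with $\alpha c<1$. Let $(\delta_n)$ be a sequence of real numbers with $\lim_{n\to\infty}\delta_n(\log n)^{\alpha c}=0$, and define the random set $\mathcal A_n=\{u\in\mathbb Z:\ \xi(u,n)\ge(1-\delta_n)\lambda_0\log n\}$. Then $$\lim_{n\to\infty}\max_{u\in\mathcal A_n}\max_{|z|\le c\log\log n}\left|\frac{\xi(u+z,n)}{m_z\lambda_0\log n}-1\right|=0\quad\text{a.s.}$$
   Context: Let $0<q<p<1$ with $p+q=1$, $h=q/p$, $\lambda_0=-1/\log(2q)$. Let $X_1,X_2,\dots$ be i.i.d. with $\mathbf P(X_1=1)=p$, $\mathbf P(X_1=-1)=q$, $S_0=0$, $S_n=X_1+\dots+X_n$. For $z\in\mathbb Z$, $n\ge1$, let $\xi(z,n)=\#\{k:0<k\le n,\ S_k=z\}$. For $z\in\mathbb Z$ put $m_z=h^{|z|}/(2q)$ if $z\ne0$ and $m_0=1$. The maximum over $z$ runs over integers $z$. *)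

theory Defs
  imports "HOL-Probability.Probability"
begin

definition walk :: "(nat \<Rightarrow> 'a \<Rightarrow> int) \<Rightarrow> nat \<Rightarrow> 'a \<Rightarrow> int" where
  "walk X n \<omega> = (\<Sum>i\<in>{1..n}. X i \<omega>)"

definition local_time :: "(nat \<Rightarrow> 'a \<Rightarrow> int) \<Rightarrow> int \<Rightarrow> nat \<Rightarrow> 'a \<Rightarrow> nat" where
  "local_time X z n \<omega> = card {k. 0 < k \<and> k \<le> n \<and> walk X k \<omega> = z}"

definition lambda0 :: "real \<Rightarrow> real" where
  "lambda0 q = - 1 / ln (2 * q)"

definition mz :: "real \<Rightarrow> real \<Rightarrow> int \<Rightarrow> real" where
  "mz p q z = (if z = 0 then 1 else (q / p) ^ nat \<bar>z\<bar> / (2 * q))"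

end

(*
  For a weight w on the integers and a function phi with E w(x + X) phi(x + X) <= phi(x), the
  process phi(S_n) * prod_{k <= n} w(S_k) is a supermartingale, so that the product exceeds l at
  some time with probability O(1/l). Taking w = a at u, w = b at u + z and w = 1 elsewhere, with
  the critical pair (a, b) read off from an explicit function that is harmonic off two points,
  bounds the probability that a^{xi(u,m)} b^{xi(u+z,m)} is ever large. At criticality
  a is about (2q)^{-1} exp(- m_z (b - 1)). With b slightly above (below) 1 this shows that
  xi(u,n) >= K together with an atypically large (small) xi(u+z,n) has probability at most
  (2q)^K exp(- const * m_z * K), up to a factor h^{-|z|}. For K near lambda_0 log n and
  |z| <= c log log n the second factor is exp(- const * (log n)^{1 - alpha c}), which beats both
  the loss caused by delta_n and the number of pairs (u, z). As the bound holds uniformly in time,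
  it suffices to sum it over n = 2^j.
*)

theory Submission
  imports Defs "HOL-Real_Asymp.Real_Asymp"
begin

subsection \<open>Local times and dyadic scales\<close>

lemma walk_0 [simp]: "walk X 0 \<omega> = 0"
  by (simp add: walk_def)

lemma walk_Suc: "walk X (Suc n) \<omega> = walk X n \<omega> + X (Suc n) \<omega>"
  by (simp add: walk_def)

lemma local_time_0 [simp]: "local_time X u 0 \<omega> = 0"
proof -
  have "{k :: nat. 0 < k \<and> k \<le> 0 \<and> walk X k \<omega> = u} = {}"
    by auto
  then show ?thesis
    unfolding local_time_def by (metis card.empty)
qed

lemma local_time_Suc:
  "local_time X u (Suc n) \<omega> = local_time X u n \<omega> + (if walk X (Suc n) \<omega> = u then 1 else 0)"
proof -
  have "{k. 0 < k \<and> k \<le> Suc n \<and> walk X k \<omega> = u} =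
      (if walk X (Suc n) \<omega> = u then {Suc n} else {}) \<union> {k. 0 < k \<and> k \<le> n \<and> walk X k \<omega> = u}"
    using le_Suc_eq by auto
  then show ?thesis
    by (simp add: local_time_def)
qed

text \<open>Each visit to \<open>u\<close> contributes a factor \<open>a\<close>, each visit to
  \<open>v\<close> a factor \<open>b\<close>. This turns a product of weights along the path into a
  statement about two local times.\<close>

lemma prod_walk_eq_local_time:
  fixes a b :: real
  assumes "u \<noteq> v"
  shows "(\<Prod>k\<in>{1..m}. if walk X k \<omega> = u then a else if walk X k \<omega> = v then b else 1) =
    a ^ local_time X u m \<omega> * b ^ local_time X v m \<omega>"
  using assms by (induction m) (auto simp: local_time_Suc)

text \<open>\<open>2 ^ j\<close> is the dyadic number next above \<open>n\<close>. The logarithms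
  differ by at most \<open>ln 2\<close>, so a bound valid up to time \<open>2 ^ j\<close> costs only
  a bounded error at time \<open>n\<close>.\<close>

lemma le_two_power_ceiling_log:
  fixes n :: nat
  assumes "2 \<le> n"
  defines "j \<equiv> nat \<lceil>log 2 (real n)\<rceil>"
  shows "n \<le> 2 ^ j" "ln (real n) \<le> real j * ln 2" "real j * ln 2 \<le> ln (real n) + ln 2"
proof -
  have pos: "0 < log 2 (real n)"
    using assms by simp
  then have j: "log 2 (real n) \<le> real j" "real j \<le> log 2 (real n) + 1"
    unfolding j_def by linarith+
  have "log 2 (real n) * ln 2 = ln (real n)"
    by (simp add: log_def)
  with mult_right_mono[OF j(1), of "ln 2"] mult_right_mono[OF j(2), of "ln 2"]
  show *: "ln (real n) \<le> real j * ln 2" "real j * ln 2 \<le> ln (real n) + ln 2"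
    by (auto simp: distrib_right)
  have "real n = 2 powr log 2 (real n)"
    using assms by simp
  also have "\<dots> \<le> 2 powr real j"
    using j(1) by (intro powr_mono) auto
  also have "\<dots> = real (2 ^ j)"
    by (simp add: powr_realpow)
  finally show "n \<le> 2 ^ j"
    by simp
qed

lemma abs_walk_le:
  assumes "\<forall>i\<ge>1. X i \<omega> = 1 \<or> X i \<omega> = -1"
  shows "\<bar>walk X n \<omega>\<bar> \<le> int n"
proof (induction n)
  case (Suc n)
  have "\<bar>X (Suc n) \<omega>\<bar> = 1"
    using assms[rule_format, of "Suc n"] by auto
  with Suc show ?case
    by (simp add: walk_Suc)
qed simp

text \<open>This leaves finitely many sites \<open>u\<close> for the union bound.\<close>

lemma abs_le_of_local_time_pos:
  assumes "\<forall>i\<ge>1. X i \<omega> = 1 \<or> X i \<omega> = -1" "0 < local_time X u n \<omega>"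
  shows "\<bar>u\<bar> \<le> int n"
proof -
  have "{k. 0 < k \<and> k \<le> n \<and> walk X k \<omega> = u} \<noteq> {}"
    using assms(2) unfolding local_time_def by (metis card.empty less_irrefl)
  then obtain k where "k \<le> n" "walk X k \<omega> = u"
    by blast
  then show ?thesis
    using abs_walk_le[where X = X and \<omega> = \<omega>, OF assms(1), of k] by auto
qed

lemma finite_abs_le: "finite {z::int. z \<noteq> 0 \<and> real_of_int \<bar>z\<bar> \<le> r}"
  and card_abs_le: "0 \<le> r \<Longrightarrow> real (card {z::int. z \<noteq> 0 \<and> real_of_int \<bar>z\<bar> \<le> r}) \<le> 2 * r + 1"
proof -
  have sub: "{z::int. z \<noteq> 0 \<and> real_of_int \<bar>z\<bar> \<le> r} \<subseteq> {- \<lfloor>r\<rfloor>..\<lfloor>r\<rfloor>}"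
  proof
    fix z :: int
    assume "z \<in> {z. z \<noteq> 0 \<and> real_of_int \<bar>z\<bar> \<le> r}"
    then have "\<bar>z\<bar> \<le> \<lfloor>r\<rfloor>"
      unfolding le_floor_iff by simp
    then show "z \<in> {- \<lfloor>r\<rfloor>..\<lfloor>r\<rfloor>}"
      by auto
  qed
  then show "finite {z::int. z \<noteq> 0 \<and> real_of_int \<bar>z\<bar> \<le> r}"
    using finite_subset by blast
  assume "0 \<le> r"
  have "card {z::int. z \<noteq> 0 \<and> real_of_int \<bar>z\<bar> \<le> r} \<le> card {- \<lfloor>r\<rfloor>..\<lfloor>r\<rfloor>}"
    using sub by (intro card_mono) auto
  also have "real \<dots> = 2 * real_of_int \<lfloor>r\<rfloor> + 1"
    using \<open>0 \<le> r\<close> by simp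
  also have "\<dots> \<le> 2 * r + 1"
    by simp
  finally show "real (card {z::int. z \<noteq> 0 \<and> real_of_int \<bar>z\<bar> \<le> r}) \<le> 2 * r + 1"
    by simp
qed

text \<open>Up to a constant these are the probability bounds over dyadic scales; for
  \<open>\<beta> > 0\<close> the stretched exponential beats every power of
  \<open>j\<close>.\<close>

lemma summable_stretched_exponential:
  fixes \<beta> \<gamma> \<eta> c :: real
  assumes "0 < \<beta>" "0 < \<eta>"
  shows "summable (\<lambda>j. (2 * c * ln (real j * ln 2) + 1) * (real j * ln 2) powr \<gamma> *
    exp (- (\<eta> * (real j * ln 2) powr \<beta>)))"
proof (rule summable_comparison_test_bigo)
  show "summable (\<lambda>j. norm (1 / real j ^ 2))"
    using inverse_power_summable[of 2, where ?'a = real] by (simp add: field_simps)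
  show "(\<lambda>j. (2 * c * ln (real j * ln 2) + 1) * (real j * ln 2) powr \<gamma> *
    exp (- (\<eta> * (real j * ln 2) powr \<beta>))) \<in> O(\<lambda>j. 1 / real j ^ 2)"
    using assms by real_asymp
qed

subsection \<open>A maximal inequality for weighted paths\<close>

locale biased_walk = prob_space M for M :: "'a measure" +
  fixes X :: "nat \<Rightarrow> 'a \<Rightarrow> int" and p q :: real
  assumes q_pos: "0 < q" and q_less_p: "q < p" and p_plus_q: "p + q = 1"
    and indep_X: "indep_vars (\<lambda>_. count_space UNIV) X {1..}"
    and prob_up: "i \<ge> 1 \<Longrightarrow> prob {\<omega> \<in> space M. X i \<omega> = 1} = p"
    and prob_down: "i \<ge> 1 \<Longrightarrow> prob {\<omega> \<in> space M. X i \<omega> = -1} = q"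
begin

lemma X_measurable: "i \<ge> 1 \<Longrightarrow> X i \<in> M \<rightarrow>\<^sub>M count_space UNIV"
  using indep_X by (auto simp: indep_vars_def)

lemma AE_X_step: "AE \<omega> in M. \<forall>i\<ge>1. X i \<omega> = 1 \<or> X i \<omega> = -1"
proof -
  have "AE \<omega> in M. X i \<omega> = 1 \<or> X i \<omega> = -1" if "i \<ge> 1" for i
  proof -
    note [measurable] = X_measurable[OF that]
    have "{\<omega> \<in> space M. X i \<omega> = 1 \<or> X i \<omega> = -1} =
        {\<omega> \<in> space M. X i \<omega> = 1} \<union> {\<omega> \<in> space M. X i \<omega> = -1}"
      by auto
    then have "prob {\<omega> \<in> space M. X i \<omega> = 1 \<or> X i \<omega> = -1} = p + q"
      by (simp, subst finite_measure_Union) (auto simp: prob_up[OF that] prob_down[OF that])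
    then show ?thesis
      using p_plus_q by (subst prob_Collect_eq_1[symmetric]) auto
  qed
  then show ?thesis
    by (simp add: AE_all_countable)
qed

lemma measurable_path_event:
  fixes w :: "int \<Rightarrow> real" and r n :: nat
  shows "Measurable.pred (PiM {r<..r + n} (\<lambda>_. count_space UNIV))
    (\<lambda>f. \<exists>m\<le>n. l \<le> (\<Prod>k\<in>{1..m}. w (x + (\<Sum>i\<in>{r<..r + k}. f i))))"
proof -
  let ?N = "PiM {r<..r + n} (\<lambda>_. count_space (UNIV :: int set))"
  have [measurable]: "(\<lambda>f. w (x + (\<Sum>i\<in>{r<..r + k}. f i))) \<in> borel_measurable ?N" if "k \<le> n" for k
  proof -
    have [measurable]: "(\<lambda>f. real_of_int (f i)) \<in> borel_measurable ?N" if "i \<in> {r<..r + k}" for i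
      using that \<open>k \<le> n\<close> order_trans[of i "r + k" "r + n"]
      by (intro measurable_compose[OF measurable_component_singleton, where L = borel]) auto
    \<comment> \<open>The integer position is written as the floor of a real sum: real sums are
      measurable, and every \<open>w\<close> is measurable on the discrete integers.\<close>
    have "(\<lambda>f. w \<lfloor>real_of_int x + (\<Sum>i\<in>{r<..r + k}. real_of_int (f i))\<rfloor>) \<in> borel_measurable ?N"
      by (rule measurable_compose[where N = "count_space UNIV"]) measurable
    then show ?thesis
      by (simp flip: of_int_sum of_int_add)
  qed
  have [measurable]: "(\<lambda>f. \<Prod>k\<in>{1..m}. w (x + (\<Sum>i\<in>{r<..r + k}. f i))) \<in> borel_measurable ?N"
    if "m \<le> n" for m
    using that by (intro borel_measurable_prod) auto
  have "Measurable.pred ?N (\<lambda>f. \<exists>m\<in>{..n}. l \<le> (\<Prod>k\<in>{1..m}. w (x + (\<Sum>i\<in>{r<..r + k}. f i))))"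
    by (intro pred_intros_finite) (auto intro!: borel_measurable_le simp: pred_def)
  then show ?thesis
    by (simp add: Bex_def)
qed

text \<open>Starting time \<open>r\<close> and starting point \<open>x\<close> both vary because the
  induction on the horizon restarts the path after its first step.\<close>

definition path_event :: "(int \<Rightarrow> real) \<Rightarrow> nat \<Rightarrow> nat \<Rightarrow> int \<Rightarrow> real \<Rightarrow> 'a set" where
  "path_event w n r x l =
    {\<omega> \<in> space M. \<exists>m\<le>n. l \<le> (\<Prod>k\<in>{1..m}. w (x + (\<Sum>i\<in>{r<..r + k}. X i \<omega>)))}"

text \<open>Only the steps \<open>r + 1\<close> to \<open>r + n\<close> matter. In this form the
  event is a preimage from the product space over \<open>{r<..r + n}\<close>, which gives its
  measurability and its independence of \<open>X r\<close>.\<close>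

lemma path_event_restrict:
  "path_event w n r x l = {\<omega> \<in> space M. \<exists>m\<le>n. l \<le>
    (\<Prod>k\<in>{1..m}. w (x + (\<Sum>i\<in>{r<..r + k}. restrict (\<lambda>i. X i \<omega>) {r<..r + n} i)))}"
proof -
  have "(\<Sum>i\<in>{r<..r + k}. restrict (\<lambda>i. X i \<omega>) {r<..r + n} i) = (\<Sum>i\<in>{r<..r + k}. X i \<omega>)" if "k \<le> n" for k \<omega>
    using that by (intro sum.cong) auto
  then have "(\<Prod>k\<in>{1..m}. w (x + (\<Sum>i\<in>{r<..r + k}. restrict (\<lambda>i. X i \<omega>) {r<..r + n} i))) =
      (\<Prod>k\<in>{1..m}. w (x + (\<Sum>i\<in>{r<..r + k}. X i \<omega>)))" if "m \<le> n" for m \<omega>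
    using that by (intro prod.cong) auto
  then show ?thesis
    unfolding path_event_def by (intro Collect_cong conj_cong refl ex_cong1) metis
qed

lemma path_event_sets [measurable]: "path_event w n r x l \<in> events"
proof -
  have "(\<lambda>\<omega>. restrict (\<lambda>i. X i \<omega>) {r<..r + n}) \<in> M \<rightarrow>\<^sub>M PiM {r<..r + n} (\<lambda>_. count_space UNIV)"
    using X_measurable by (intro measurable_restrict) auto
  from measurable_compose[OF this measurable_path_event]
  show ?thesis
    unfolding path_event_restrict by measurable
qed

lemma path_event_indep:
  assumes "r \<ge> 1"
  shows "prob ({\<omega> \<in> space M. X r \<omega> = e} \<inter> path_event w n r x l) =
    prob {\<omega> \<in> space M. X r \<omega> = e} * prob (path_event w n r x l)"
proof -
  let ?N = "\<lambda>I. PiM I (\<lambda>_. count_space (UNIV :: int set))"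
  let ?Q = "\<lambda>f. \<exists>m\<le>n. l \<le> (\<Prod>k\<in>{1..m}. w (x + (\<Sum>i\<in>{r<..r + k}. f i)))"
  have ind: "indep_var (?N {r}) (\<lambda>\<omega>. restrict (\<lambda>i. X i \<omega>) {r})
      (?N {r<..r + n}) (\<lambda>\<omega>. restrict (\<lambda>i. X i \<omega>) {r<..r + n})"
    using assms by (intro indep_var_restrict[OF indep_X]) auto
  have A: "{f \<in> space (?N {r}). f r = e} \<in> sets (?N {r})"
    using measurable_component_singleton[of r "{r}" "\<lambda>_. count_space (UNIV :: int set)"] by measurable
  have B: "{f \<in> space (?N {r<..r + n}). ?Q f} \<in> sets (?N {r<..r + n})"
    using measurable_path_event[where r = r and n = n and l = l and w = w and x = x] by measurable
  have 1: "(\<lambda>\<omega>. restrict (\<lambda>i. X i \<omega>) {r}) -` {f \<in> space (?N {r}). f r = e} \<inter> space M =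
      {\<omega> \<in> space M. X r \<omega> = e}"
    by (auto simp: space_PiM)
  have 2: "(\<lambda>\<omega>. restrict (\<lambda>i. X i \<omega>) {r<..r + n}) -` {f \<in> space (?N {r<..r + n}). ?Q f} \<inter> space M =
      path_event w n r x l"
    unfolding path_event_restrict by (auto simp: space_PiM simp del: restrict_apply)
  have "(\<lambda>x. (f x, g x)) -` (S \<times> T) \<inter> space M = (f -` S \<inter> space M) \<inter> (g -` T \<inter> space M)"
    for f :: "'a \<Rightarrow> nat \<Rightarrow> int" and g :: "'a \<Rightarrow> nat \<Rightarrow> int" and S T
    by auto
  then show ?thesis
    using indep_varD[OF ind A B] unfolding 1 2 by (simp only: 1 2)
qed

lemma prod_path_shift:
  fixes f :: "nat \<Rightarrow> int" and w :: "int \<Rightarrow> real"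
  shows "(\<Prod>k\<in>{1..Suc m}. w (x + (\<Sum>i\<in>{r<..r + k}. f i))) =
    w (x + f (Suc r)) * (\<Prod>k\<in>{1..m}. w (x + f (Suc r) + (\<Sum>i\<in>{Suc r<..Suc r + k}. f i)))"
proof -
  have "(\<Sum>i\<in>{r<..r + Suc k}. f i) = f (Suc r) + (\<Sum>i\<in>{Suc r<..Suc r + k}. f i)" for k
  proof -
    have "{r<..r + Suc k} = insert (Suc r) {Suc r<..Suc r + k}"
      by auto
    then show ?thesis
      by simp
  qed
  note s = this
  have "(\<Prod>k\<in>{1..Suc m}. w (x + (\<Sum>i\<in>{r<..r + k}. f i))) =
      (\<Prod>k\<in>{0..m}. w (x + (\<Sum>i\<in>{r<..r + Suc k}. f i)))"
    by (simp only: One_nat_def prod.atLeast_Suc_atMost_Suc_shift o_def)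
  also have "\<dots> = w (x + (f (Suc r) + 0)) *
      (\<Prod>k\<in>{1..m}. w (x + (f (Suc r) + (\<Sum>i\<in>{Suc r<..Suc r + k}. f i))))"
    unfolding s by (subst prod.atLeast_Suc_atMost) auto
  finally show ?thesis
    by (simp add: add.assoc)
qed

text \<open>A maximal inequality for the supermartingale in question, by induction on the horizon
  with a first-step decomposition in place of stopping times. The product can first reach
  \<open>l > 1\<close> only on entering a point with \<open>w > 1\<close>, and there
  \<open>\<phi>\<close> is at least \<open>\<kappa>\<close>.\<close>

lemma superharmonic_path_bound:
  fixes w \<phi> :: "int \<Rightarrow> real"
  assumes w_pos: "\<And>y. 0 < w y" and phi_nonneg: "\<And>y. 0 \<le> \<phi> y"
    and super: "\<And>y. p * (w (y + 1) * \<phi> (y + 1)) + q * (w (y - 1) * \<phi> (y - 1)) \<le> \<phi> y"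
    and \<kappa>: "0 < \<kappa>" "\<And>y. 1 < w y \<Longrightarrow> \<kappa> \<le> \<phi> y"
    and "1 < l"
  shows "prob (path_event w n r x l) \<le> \<phi> x / (\<kappa> * l)"
  using \<open>1 < l\<close>
proof (induction n arbitrary: r x l)
  case 0
  then have "path_event w 0 r x l = {}"
    by (auto simp: path_event_def)
  then show ?case
    using 0 \<kappa>(1) phi_nonneg[of x] by simp
next
  case (Suc n)
  \<comment> \<open>After a step to \<open>y\<close> the remaining level is \<open>l / w y\<close>.
    If it is at most 1, the induction hypothesis does not apply; but then
    \<open>w y \<ge> l > 1\<close>, and \<open>\<kappa> \<le> \<phi> y\<close> makes the right-hand
    side at least 1.\<close>
  have *: "prob (path_event w n (Suc r) y (l / w y)) \<le> w y * \<phi> y / (\<kappa> * l)" for y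
  proof (cases "l / w y \<le> 1")
    case True
    then have "l \<le> w y"
      using w_pos[of y] by (simp add: field_simps)
    then have "\<kappa> * l \<le> \<phi> y * w y"
      using Suc.prems \<kappa> phi_nonneg[of y] by (intro mult_mono) auto
    then have "1 \<le> w y * \<phi> y / (\<kappa> * l)"
      using Suc.prems \<kappa> by (simp add: field_simps)
    then show ?thesis
      using prob_le_1 order_trans by blast
  next
    case False
    then show ?thesis
      using Suc.IH[of "l / w y" "Suc r" y] w_pos[of y] by (simp add: field_simps)
  qed
  let ?A = "\<lambda>e. {\<omega> \<in> space M. X (Suc r) \<omega> = e} \<inter> path_event w n (Suc r) (x + e) (l / w (x + e))"
  note [measurable] = X_measurable[of "Suc r", simplified]
  have "AE \<omega> in M. \<omega> \<in> path_event w (Suc n) r x l \<longrightarrow> \<omega> \<in> ?A 1 \<union> ?A (-1)"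
    using AE_X_step
  proof eventually_elim
    case (elim \<omega>)
    show ?case
    proof
      assume "\<omega> \<in> path_event w (Suc n) r x l"
      then obtain m where m: "m \<le> Suc n" "l \<le> (\<Prod>k\<in>{1..m}. w (x + (\<Sum>i\<in>{r<..r + k}. X i \<omega>)))"
        and sp: "\<omega> \<in> space M"
        by (auto simp: path_event_def)
      \<comment> \<open>\<open>m = 0\<close> is excluded, as the empty product 1 is below
        \<open>l\<close>.\<close>
      with Suc.prems obtain m' where m': "m = Suc m'"
        by (cases m) auto
      define e where "e = X (Suc r) \<omega>"
      have "l / w (x + e) \<le> (\<Prod>k\<in>{1..m'}. w (x + e + (\<Sum>i\<in>{Suc r<..Suc r + k}. X i \<omega>)))"
        using m(2) w_pos[of "x + e"] unfolding m' prod_path_shift e_def by (simp add: field_simps)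
      then have "\<omega> \<in> ?A e"
        using sp m(1) m' by (auto simp: path_event_def e_def)
      moreover have "e = 1 \<or> e = -1"
        using elim by (auto simp: e_def)
      ultimately show "\<omega> \<in> ?A 1 \<union> ?A (-1)"
        by auto
    qed
  qed
  then have "prob (path_event w (Suc n) r x l) \<le> prob (?A 1 \<union> ?A (-1))"
    by (intro finite_measure_mono_AE) measurable
  also have "\<dots> \<le> prob (?A 1) + prob (?A (-1))"
    by (intro measure_Un_le) measurable
  also have "\<dots> = p * prob (path_event w n (Suc r) (x + 1) (l / w (x + 1))) +
      q * prob (path_event w n (Suc r) (x + (-1)) (l / w (x + (-1))))"
    by (subst (1 2) path_event_indep) (auto simp: prob_up prob_down)
  also have "\<dots> \<le> p * (w (x + 1) * \<phi> (x + 1) / (\<kappa> * l)) +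
      q * (w (x + (-1)) * \<phi> (x + (-1)) / (\<kappa> * l))"
    using q_pos q_less_p by (intro add_mono mult_left_mono *) auto
  also have "\<dots> = (p * (w (x + 1) * \<phi> (x + 1)) + q * (w (x - 1) * \<phi> (x - 1))) / (\<kappa> * l)"
    by (simp add: add_divide_distrib)
  also have "\<dots> \<le> \<phi> x / (\<kappa> * l)"
    using super[of x] \<kappa>(1) Suc.prems by (intro divide_right_mono) auto
  finally show ?case .
qed

subsection \<open>The two-point tilt\<close>

definition h :: real where "h = q / p"

lemma p_pos: "0 < p" and h_pos: "0 < h" and h_less_1: "h < 1" and q_less_half: "q < 1 / 2"
  using q_pos q_less_p p_plus_q by (auto simp: h_def)

lemma p_times_h: "p * h = q"
  using p_pos by (simp add: h_def)

text \<open>\<open>2 * q\<close> is the return probability of the walk, so \<open>s = 0\<close>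
  gives the critical weight at a single point and weight 1 at the neighbour. For small
  \<open>s > 0\<close> the neighbour's weight \<open>b_tilt\<close> exceeds 1 and
  \<open>a_tilt\<close> drops below \<open>1 / (2 * q)\<close>; for \<open>s < 0\<close> it is the
  reverse.\<close>

definition a_tilt :: "real \<Rightarrow> int \<Rightarrow> real" where
  "a_tilt s z = 1 / (2 * q + (p - q) * s * h ^ nat \<bar>z\<bar>)"

definition b_tilt :: "real \<Rightarrow> int \<Rightarrow> real" where
  "b_tilt s z = (1 + s - s * h ^ nat \<bar>z\<bar>) / (1 + 2 * q * s - s * h ^ nat \<bar>z\<bar>)"

text \<open>As the drift is to the right, \<open>h powi max (x - c) 0\<close> is the probability of
  ever reaching \<open>c\<close> from \<open>x\<close>, and \<open>h powi max x c\<close> is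
  \<open>h powi c\<close> times it. Hence it is harmonic off \<open>c\<close>, and at
  \<open>c\<close> the return probability \<open>2 * q\<close> appears.\<close>

lemma step_mean_h_powi_max:
  "p * h powi max (x + 1) c + q * h powi max (x - 1) c =
    (if x = c then 2 * q * h powi c else h powi max x c)"
proof -
  have up: "p * h powi (x + 1) = q * h powi x" for x
    using h_pos p_times_h by (simp add: power_int_add mult.assoc[symmetric] mult.commute)
  have down: "q * h powi (x - 1) = p * h powi x" for x
    using up[of "x - 1"] by simp
  have pq: "p * y + q * y = y" for y
    using p_plus_q by (simp flip: distrib_right)
  consider "x < c" | "x = c" | "x > c"
    by linarith
  then show ?thesis
  proof cases
    case 1
    then show ?thesis
      using pq by (simp add: max_def)
  next
    case 2
    then show ?thesis
      using up[of c] by (simp add: max_def)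
  next
    case 3
    then have "max x c = x" "max (x + 1) c = x + 1" "max (x - 1) c = x - 1"
      by auto
    then show ?thesis
      using 3 up[of x] down[of x] pq[of "h powi x"] by simp
  qed
qed

text \<open>
  The perturbation of \<open>h powi max x 0\<close> is chosen so that \<open>tilt_fun s z\<close> is harmonic off
  \<open>{0, z}\<close>. The weights \<open>a_tilt\<close> at \<open>0\<close> and \<open>b_tilt\<close> at \<open>z\<close> are the quotients
  \<open>tilt_fun / tilt_mean\<close> there, which makes \<open>tilt_mean\<close> harmonic for the weighted walk.
\<close>

definition tilt_fun :: "real \<Rightarrow> int \<Rightarrow> int \<Rightarrow> real" where
  "tilt_fun s z x = h powi max x 0 +
    s * (h powi max 0 (- z) * h powi max x z - h powi \<bar>z\<bar> * h powi max x 0)"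

definition tilt_mean :: "real \<Rightarrow> int \<Rightarrow> int \<Rightarrow> real" where
  "tilt_mean s z x = p * tilt_fun s z (x + 1) + q * tilt_fun s z (x - 1)"

text \<open>With P_x(y) the probability of reaching y from x, the bracket in \<open>tilt_fun\<close>
  is P_x(z) P_z(0) - P_x(0) P_0(z) P_z(0). It lies between 0 and P_x(0), which is
  \<open>h powi max x 0\<close>; the proof reads this off from the exponents.\<close>

lemma tilt_fun_bounds:
  assumes "\<bar>s\<bar> \<le> 1"
  shows "0 \<le> tilt_fun s z x" "tilt_fun s z x \<le> 2"
proof -
  define D where "D = h powi max 0 (- z) * h powi max x z - h powi \<bar>z\<bar> * h powi max x 0"
  have "h powi (\<bar>z\<bar> + max x 0) \<le> h powi (max 0 (- z) + max x z)"
    using h_pos h_less_1 by (intro power_int_decreasing) auto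
  then have D0: "0 \<le> D"
    using h_pos by (simp add: D_def power_int_add)
  have "h powi (max 0 (- z) + max x z) \<le> h powi max x 0"
    using h_pos h_less_1 by (intro power_int_decreasing) auto
  then have "h powi max 0 (- z) * h powi max x z \<le> h powi max x 0"
    using h_pos by (simp add: power_int_add)
  moreover have "0 \<le> h powi \<bar>z\<bar> * h powi max x 0"
    using h_pos by simp
  ultimately have D1: "D \<le> h powi max x 0"
    unfolding D_def by linarith
  have "h powi max x 0 \<le> h powi 0"
    using h_pos h_less_1 by (intro power_int_decreasing) auto
  then have g: "h powi max x 0 \<le> 1"
    by simp
  have "\<bar>s * D\<bar> \<le> 1 * D"
    using assms D0 by (simp only: abs_mult) (intro mult_mono, auto)
  then show "0 \<le> tilt_fun s z x" "tilt_fun s z x \<le> 2"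
    using D0 D1 g unfolding tilt_fun_def D_def[symmetric] by linarith+
qed

text \<open>Each truncated power is harmonic except at its corner \<open>c\<close>, where its mean
  falls short by \<open>(p - q) * h powi c\<close>; the two corners give the two
  corrections.\<close>

lemma tilt_mean_eq:
  assumes "z \<noteq> 0"
  shows "tilt_mean s z x = tilt_fun s z x -
    (p - q) * ((if x = 0 then 1 - s * h powi \<bar>z\<bar> else 0) + (if x = z then s * h powi max z 0 else 0))"
proof -
  have 1: "1 - 2 * q = p - q"
    using p_plus_q by simp
  have *: "p * h powi max (x + 1) c + q * h powi max (x - 1) c =
      h powi max x c - (if x = c then (p - q) * h powi c else 0)" for c
    unfolding step_mean_h_powi_max 1[symmetric] by (simp add: algebra_simps)
  have "tilt_mean s z x = (1 - s * h powi \<bar>z\<bar>) * (p * h powi max (x + 1) 0 + q * h powi max (x - 1) 0) +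
      s * h powi max 0 (- z) * (p * h powi max (x + 1) z + q * h powi max (x - 1) z)"
    unfolding tilt_mean_def tilt_fun_def by (simp only: algebra_simps)
  also have "\<dots> = tilt_fun s z x - (p - q) * ((if x = 0 then 1 - s * h powi \<bar>z\<bar> else 0) +
      (if x = z then s * (h powi max 0 (- z) * h powi z) else 0))"
    unfolding * tilt_fun_def using assms by (cases "x = 0"; cases "x = z") (auto simp: algebra_simps)
  also have "h powi max 0 (- z) * h powi z = h powi max z 0"
    using h_pos by (subst power_int_add[symmetric]) (auto simp: max_def)
  finally show ?thesis .
qed

lemma tilt_denominators:
  assumes "\<bar>s\<bar> \<le> q / 2"
  shows "q \<le> 2 * q + (p - q) * s * h ^ nat \<bar>z\<bar>"
    and "1 / 2 \<le> 1 + 2 * q * s - s * h ^ nat \<bar>z\<bar>"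
    and "1 / 2 \<le> 1 + s - s * h ^ nat \<bar>z\<bar>"
proof -
  define H where "H = h ^ nat \<bar>z\<bar>"
  have H: "0 < H" "H \<le> 1"
    using h_pos h_less_1 by (auto simp: H_def power_le_one)
  have s1: "\<bar>s\<bar> < 1 / 4"
    using assms q_less_half by linarith
  have sH: "\<bar>s * H\<bar> \<le> \<bar>s\<bar>"
    using H by (simp add: abs_mult mult_left_le)
  have qs: "\<bar>2 * q * s\<bar> \<le> \<bar>s\<bar>"
    using q_pos q_less_half by (simp add: abs_mult mult_left_le_one_le)
  have "\<bar>(p - q) * (s * H)\<bar> \<le> 1 * \<bar>s * H\<bar>"
    using q_less_p p_plus_q q_pos unfolding abs_mult by (intro mult_right_mono) auto
  then show "q \<le> 2 * q + (p - q) * s * h ^ nat \<bar>z\<bar>"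
    using sH assms q_pos unfolding H_def[symmetric] by (simp add: mult.assoc)
  show "1 / 2 \<le> 1 + 2 * q * s - s * h ^ nat \<bar>z\<bar>" "1 / 2 \<le> 1 + s - s * h ^ nat \<bar>z\<bar>"
    unfolding H_def[symmetric] using s1 sH qs by linarith+
qed

lemma tilt_pos:
  assumes "\<bar>s\<bar> \<le> q / 2"
  shows "0 < a_tilt s z" "0 < b_tilt s z"
  using tilt_denominators[OF assms, of z] q_pos by (auto simp: a_tilt_def b_tilt_def)

text \<open>The maximal inequality applies with \<open>\<phi>\<close> equal to
  \<open>tilt_mean\<close> recentred at \<open>u\<close>. The factor
  \<open>h ^ nat \<bar>z\<bar>\<close> is the price for a lower bound of \<open>\<phi>\<close> at
  the two weighted points.\<close>

lemma two_point_bound: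
  assumes "z \<noteq> 0" and s: "\<bar>s\<bar> \<le> q / 2" and "1 < l"
  shows "{\<omega> \<in> space M. \<exists>m\<le>n. l \<le>
      a_tilt s z ^ local_time X u m \<omega> * b_tilt s z ^ local_time X (u + z) m \<omega>} \<in> events" 
    and "prob {\<omega> \<in> space M. \<exists>m\<le>n. l \<le>
      a_tilt s z ^ local_time X u m \<omega> * b_tilt s z ^ local_time X (u + z) m \<omega>}
      \<le> 2 / (q * h ^ nat \<bar>z\<bar> * l)"
proof -
  let ?E = "{\<omega> \<in> space M. \<exists>m\<le>n. l \<le>
      a_tilt s z ^ local_time X u m \<omega> * b_tilt s z ^ local_time X (u + z) m \<omega>}"
  define H where "H = h ^ nat \<bar>z\<bar>"
  have H: "0 < H" "H \<le> 1"
    using h_pos h_less_1 by (auto simp: H_def power_le_one)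
  have H_eq: "h powi \<bar>z\<bar> = H"
    by (simp add: H_def power_int_def)
  define w where "w y = (if y = u then a_tilt s z else if y = u + z then b_tilt s z else 1)" for y
  define \<phi> where "\<phi> y = tilt_mean s z (y - u)" for y
  note den_a = tilt_denominators(1)[OF s, of z, folded H_def]
    and den_b = tilt_denominators(2)[OF s, of z, folded H_def]
  have a_pos: "0 < a_tilt s z" and b_pos: "0 < b_tilt s z"
    using tilt_pos[OF s] by auto
  have phi_u: "\<phi> u = 2 * q + (p - q) * s * H"
  proof -
    have "max 0 (- z) + max 0 z = \<bar>z\<bar>"
      by simp
    then have "h powi max 0 (- z) * h powi max 0 z = H"
      using h_pos by (metis H_eq power_int_add less_irrefl)
    then have "tilt_fun s z 0 = 1"
      unfolding tilt_fun_def H_eq by simp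
    then have "\<phi> u = 1 - (p - q) * (1 - s * H)"
      using \<open>z \<noteq> 0\<close> by (simp add: \<phi>_def tilt_mean_eq H_eq)
    then show ?thesis
      using p_plus_q by (simp add: algebra_simps)
  qed
  have fun_z: "tilt_fun s z z = h powi max z 0 * (1 + s - s * H)"
  proof -
    have "max 0 (- z) + z = max z 0"
      by simp
    then have "h powi max 0 (- z) * h powi z = h powi max z 0"
      using h_pos by (metis power_int_add less_irrefl)
    then show ?thesis
      unfolding tilt_fun_def H_eq by (simp add: algebra_simps)
  qed
  have phi_z: "\<phi> (u + z) = h powi max z 0 * (1 + 2 * q * s - s * H)"
  proof -
    have "\<phi> (u + z) = h powi max z 0 * (1 + s - s * H) - (p - q) * (s * h powi max z 0)"
      using \<open>z \<noteq> 0\<close> by (simp add: \<phi>_def tilt_mean_eq fun_z)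
    also have "p - q = 1 - 2 * q"
      using p_plus_q by simp
    finally show ?thesis
      by (simp add: algebra_simps)
  qed
  \<comment> \<open>Since \<open>w y * \<phi> y\<close> is the recentred \<open>tilt_fun\<close> and
    \<open>\<phi>\<close> its one-step mean, the superharmonicity condition holds with
    equality.\<close>
  have w_phi: "w y * \<phi> y = tilt_fun s z (y - u)" for y
  proof -
    consider "y = u" | "y = u + z" | "y \<noteq> u" "y \<noteq> u + z"
      by blast
    then show ?thesis
    proof cases
      case 1
      have "tilt_fun s z 0 = \<phi> u + (p - q) * (1 - s * H)"
        using \<open>z \<noteq> 0\<close> by (simp add: \<phi>_def tilt_mean_eq H_eq)
      also have "\<dots> = 1"
        using p_plus_q unfolding phi_u by (simp add: algebra_simps)
      finally show ?thesis
        using den_a q_pos by (simp add: 1 phi_u w_def a_tilt_def H_def[symmetric])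
    next
      case 2
      then show ?thesis
        using den_b \<open>z \<noteq> 0\<close> by (simp add: phi_z fun_z w_def b_tilt_def H_def[symmetric])
    next
      case 3
      then show ?thesis
        using \<open>z \<noteq> 0\<close> by (simp add: w_def \<phi>_def tilt_mean_eq)
    qed
  qed
  have hz: "H \<le> h powi max z 0"
    unfolding H_eq[symmetric] using h_pos h_less_1 by (intro power_int_decreasing) auto
  \<comment> \<open>For \<open>z > 0\<close> the value of \<open>\<phi>\<close> at
    \<open>u + z\<close> is of order \<open>h powi z\<close>, which is where the factor
    \<open>H\<close> comes from.\<close>
  have kappa: "q * H \<le> \<phi> y" if "1 < w y" for y
  proof -
    have "y = u \<or> y = u + z"
      using that by (auto simp: w_def split: if_splits)
    then show ?thesis
    proof
      assume "y = u"
      then show ?thesis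
        using den_a H mult_left_le[of H q] q_pos order_trans[of "q * H" q] by (simp add: phi_u)
    next
      assume "y = u + z"
      have "H * q \<le> h powi max z 0 * (1 + 2 * q * s - s * H)"
        using hz H den_b q_less_half q_pos by (intro mult_mono) auto
      then show ?thesis
        using \<open>y = u + z\<close> by (simp add: phi_z mult.commute)
    qed
  qed
  have E: "?E = path_event w n 0 0 l"
  proof -
    have "a_tilt s z ^ local_time X u m \<omega> * b_tilt s z ^ local_time X (u + z) m \<omega> =
        (\<Prod>k\<in>{1..m}. w (0 + (\<Sum>i\<in>{0<..0 + k}. X i \<omega>)))" for m \<omega>
    proof -
      have "walk X k \<omega> = 0 + (\<Sum>i\<in>{0<..0 + k}. X i \<omega>)" for k
        unfolding walk_def by (simp add: atLeastSucAtMost_greaterThanAtMost)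
      then show ?thesis
        using prod_walk_eq_local_time[of u "u + z" X \<omega> "a_tilt s z" "b_tilt s z" m] \<open>z \<noteq> 0\<close>
        by (simp only: w_def)
    qed
    then show ?thesis
      unfolding path_event_def by simp
  qed
  show "?E \<in> events"
    unfolding E by simp
  have "0 \<le> \<phi> y" "\<phi> y \<le> 2" for y
  proof -
    have t: "0 \<le> tilt_fun s z x" "tilt_fun s z x \<le> 2" for x
      using s q_less_half by (auto intro!: tilt_fun_bounds)
    show "0 \<le> \<phi> y"
      unfolding \<phi>_def tilt_mean_def using t p_pos q_pos by (intro add_nonneg_nonneg mult_nonneg_nonneg) auto
    have "\<phi> y \<le> p * 2 + q * 2"
      unfolding \<phi>_def tilt_mean_def using t p_pos q_pos by (intro add_mono mult_left_mono) auto
    then show "\<phi> y \<le> 2"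
      using p_plus_q by simp
  qed
  note phi = this
  have "prob (path_event w n 0 0 l) \<le> \<phi> 0 / (q * H * l)"
  proof (rule superharmonic_path_bound)
    show "0 < w y" for y
      using a_pos b_pos by (simp add: w_def)
    show "p * (w (y + 1) * \<phi> (y + 1)) + q * (w (y - 1) * \<phi> (y - 1)) \<le> \<phi> y" for y
    proof -
      have "y + 1 - u = y - u + 1" "y - 1 - u = y - u - 1"
        by simp_all
      then show ?thesis
        unfolding w_phi by (simp only: \<phi>_def tilt_mean_def)
    qed
  qed (use phi kappa q_pos H \<open>1 < l\<close> in auto)
  also have "\<dots> \<le> 2 / (q * H * l)"
    using phi[of 0] q_pos H \<open>1 < l\<close> by (intro divide_right_mono) auto
  finally show "prob ?E \<le> 2 / (q * h ^ nat \<bar>z\<bar> * l)"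
    unfolding E H_def .
qed

end

section \<open>Elementary bounds for the logarithm of the neighbour's weight\<close>

text \<open>With \<open>d = 1 - 2 * q\<close> the quotient is at least \<open>1 + y\<close> for
  \<open>y = d * s / (1 + s)\<close>, which is free of \<open>H\<close>, and
  \<open>ln (1 + y) \<ge> y - y\<^sup>2\<close> costs a relative error of at most
  \<open>2 * s\<close>. As \<open>q < 1 / 2\<close>, the choice of \<open>s\<close> gives
  \<open>s \<le> \<epsilon> / 20\<close>.\<close>

lemma ln_tilt_lower_up:
  fixes q s H \<epsilon> :: real
  assumes "0 < q" "q < 1 / 2" "0 < \<epsilon>" "\<epsilon> \<le> 1" "s = q * \<epsilon> / 10" "0 < H" "H \<le> 1"
  shows "(1 - 2 * q) * s * (1 - \<epsilon> / 4) \<le> ln ((1 + s - s * H) / (1 + 2 * q * s - s * H))"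
proof -
  define d where "d = 1 - 2 * q"
  have d: "0 < d" "d \<le> 1"
    using assms by (auto simp: d_def)
  have "q * \<epsilon> \<le> 1 / 2 * \<epsilon>"
    using assms by (intro mult_right_mono) auto
  moreover have "0 < q * \<epsilon>"
    using assms by simp
  ultimately have s: "0 < s" "s \<le> \<epsilon> / 20" "s \<le> 1 / 20"
    using assms by linarith+
  have sH: "0 < s * H" "s * H \<le> s"
    using \<open>0 < s\<close> assms(6,7) by (simp_all add: mult_left_le)
  have qs: "0 < 2 * q * s" "2 * q * s \<le> s"
    using \<open>0 < s\<close> assms(1,2) by (simp_all add: mult_left_le_one_le)
  have den: "0 < 1 + 2 * q * s - s * H" "1 + 2 * q * s - s * H \<le> 1 + s"
    using s sH qs by linarith+
  define y where "y = d * s / (1 + s)"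
  have "y \<le> d * s / 1"
    unfolding y_def using d s by (intro divide_left_mono) auto
  then have y: "0 < y" "y \<le> d * s"
    using d s by (auto simp: y_def)
  have "d * s \<le> 1 * (1 / 20)"
    using d s by (intro mult_mono) auto
  then have y1: "y \<le> 1"
    using y by linarith
  have "(1 - s) * (1 + s) \<le> 1"
    by (simp add: algebra_simps)
  then have "1 - s \<le> 1 / (1 + s)"
    using s by (simp add: pos_le_divide_eq)
  from mult_left_mono[OF this, of "d * s"] have y2: "d * s * (1 - s) \<le> y"
    using d s by (simp add: y_def)
  have "y\<^sup>2 \<le> (d * s) * (1 * s)"
    unfolding power2_eq_square using y d s by (intro mult_mono order_trans[OF y(2)]) auto
  with y2 have "d * s * (1 - 2 * s) \<le> y - y\<^sup>2"
    by (simp add: algebra_simps)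
  moreover have "d * s * (1 - \<epsilon> / 4) \<le> d * s * (1 - 2 * s)"
    using d s by (intro mult_left_mono) auto
  moreover have "y - y\<^sup>2 \<le> ln (1 + y)"
    using y y1 by (intro ln_one_plus_pos_lower_bound) auto
  moreover have "ln (1 + y) \<le> ln ((1 + s - s * H) / (1 + 2 * q * s - s * H))"
  proof -
    have "y \<le> d * s / (1 + 2 * q * s - s * H)"
      unfolding y_def using d s den by (intro divide_left_mono) auto
    also have "1 + d * s / (1 + 2 * q * s - s * H) = (1 + s - s * H) / (1 + 2 * q * s - s * H)"
      using den by (simp add: field_simps d_def)
    finally show ?thesis
      using y by simp
  qed
  ultimately show ?thesis
    unfolding d_def by linarith
qed

text \<open>The quotient is at least \<open>1 - y\<close> for \<open>y = d * t / (1 - t)\<close>.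
  The relative error is at most \<open>10 * t\<close>: \<open>2 * t\<close> from
  \<open>1 / (1 - t)\<close> and \<open>8 * t\<close> from the square in the bound for
  \<open>ln (1 - y)\<close>. The 10 in \<open>t\<close> turns this into at most
  \<open>\<epsilon> / 2\<close>.\<close>

lemma ln_tilt_lower_down:
  fixes q t H \<epsilon> :: real
  assumes "0 < q" "q < 1 / 2" "0 < \<epsilon>" "\<epsilon> \<le> 1" "t = q * \<epsilon> / 10" "0 < H" "H \<le> 1"
  shows "- ((1 - 2 * q) * t * (1 + \<epsilon> / 2)) \<le> ln ((1 - t + t * H) / (1 - 2 * q * t + t * H))"
    and "ln ((1 - t + t * H) / (1 - 2 * q * t + t * H)) \<le> 0"
proof -
  define d where "d = 1 - 2 * q"
  have d: "0 < d" "d \<le> 1"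
    using assms by (auto simp: d_def)
  have "q * \<epsilon> \<le> 1 / 2 * \<epsilon>"
    using assms by (intro mult_right_mono) auto
  moreover have "0 < q * \<epsilon>"
    using assms by simp
  ultimately have t: "0 < t" "t \<le> \<epsilon> / 20" "t \<le> 1 / 20"
    using assms by linarith+
  have tH: "0 < t * H" "t * H \<le> t"
    using \<open>0 < t\<close> assms(6,7) by (simp_all add: mult_left_le)
  have qt: "0 < 2 * q * t" "2 * q * t \<le> t"
    using \<open>0 < t\<close> assms(1,2) by (simp_all add: mult_left_le_one_le)
  have den: "1 - t \<le> 1 - 2 * q * t + t * H" "0 < 1 - t + t * H"
    using t tH qt by linarith+
  then have den0: "0 < 1 - 2 * q * t + t * H"
    using t by linarith
  have eq: "(1 - t + t * H) / (1 - 2 * q * t + t * H) = 1 - d * t / (1 - 2 * q * t + t * H)"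
    using den0 by (simp add: field_simps d_def)
  define y where "y = d * t / (1 - t)"
  have "1 / (1 - t) \<le> 1 + 2 * t"
  proof -
    have "t * t \<le> t * (1 / 2)"
      using t by (intro mult_left_mono) auto
    then have "1 \<le> (1 + 2 * t) * (1 - t)"
      by (simp add: algebra_simps)
    then show ?thesis
      using t by (simp add: pos_divide_le_eq)
  qed
  from mult_left_mono[OF this, of "d * t"] have y2: "y \<le> d * t * (1 + 2 * t)"
    using d t by (simp add: y_def)
  also have "\<dots> \<le> d * t * 2"
    using d t by (intro mult_left_mono) auto
  finally have y3: "y \<le> 2 * (d * t)"
    by simp
  have y0: "0 \<le> y"
    using d t by (simp add: y_def)
  have "d * t \<le> 1 * (1 / 20)"
    using d t by (intro mult_mono) auto
  then have y1: "y \<le> 1 / 2"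
    using y3 by linarith
  have "y * y \<le> (2 * (d * t)) * (2 * (1 * t))"
    using y0 d t by (intro mult_mono order_trans[OF y3]) auto
  with y2 have "- (d * t * (1 + 10 * t)) \<le> - y - 2 * y\<^sup>2"
    by (simp add: algebra_simps power2_eq_square)
  moreover have "d * t * (1 + 10 * t) \<le> d * t * (1 + \<epsilon> / 2)"
    using d t by (intro mult_left_mono) auto
  moreover have "- y - 2 * y\<^sup>2 \<le> ln (1 - y)"
    using y0 y1 by (intro ln_one_minus_pos_lower_bound) auto
  moreover have "ln (1 - y) \<le> ln ((1 - t + t * H) / (1 - 2 * q * t + t * H))"
  proof -
    have "d * t / (1 - 2 * q * t + t * H) \<le> y"
      unfolding y_def using d t den by (intro divide_left_mono) auto
    then show ?thesis
      unfolding eq using y1 by simp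
  qed
  ultimately show "- ((1 - 2 * q) * t * (1 + \<epsilon> / 2)) \<le> ln ((1 - t + t * H) / (1 - 2 * q * t + t * H))"
    unfolding d_def by linarith
  show "ln ((1 - t + t * H) / (1 - 2 * q * t + t * H)) \<le> 0"
    using den den0 qt by (subst ln_le_zero_iff) (auto simp: pos_divide_le_eq)
qed

section \<open>The tilted product at atypical local times\<close>

context biased_walk
begin

lemma mz_eq: "z \<noteq> 0 \<Longrightarrow> mz p q z = h ^ nat \<bar>z\<bar> / (2 * q)"
  by (simp add: mz_def h_def)

lemma lambda0_pos: "0 < lambda0 q" and lambda0_ln: "lambda0 q * - ln (2 * q) = 1"
  using q_pos q_less_half by (auto simp: lambda0_def field_simps)

text \<open>\<open>a_tilt s z\<close> equals \<open>1 / (2 * q * (1 + x))\<close> with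
  \<open>x = s * mz p q z * (p - q)\<close>, and \<open>ln (1 + x) \<le> x\<close>; this is where
  \<open>mz\<close> enters. The sign statement, from \<open>- ln (2 * q) \<ge> p - q\<close>,
  permits multiplication with lower bounds for local times.\<close>

lemma ln_a_tilt:
  assumes "z \<noteq> 0" "\<bar>s\<bar> \<le> q / 2"
  shows "- ln (2 * q) - s * mz p q z * (p - q) \<le> ln (a_tilt s z)"
    and "0 \<le> - ln (2 * q) - s * mz p q z * (p - q)"
proof -
  define H where "H = h ^ nat \<bar>z\<bar>"
  have H: "0 < H" "H \<le> 1"
    using h_pos h_less_1 by (auto simp: H_def power_le_one)
  define x where "x = s * mz p q z * (p - q)"
  have m: "mz p q z = H / (2 * q)"
    using assms by (simp add: mz_eq H_def)
  have "\<bar>x\<bar> = \<bar>s\<bar> * H * (p - q) / (2 * q)"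
    using q_pos q_less_p H by (simp add: x_def m abs_mult)
  also have "\<dots> \<le> q / 2 * 1 * (p - q) / (2 * q)"
    using assms q_pos q_less_p H by (intro divide_right_mono mult_right_mono mult_mono) auto
  also have "\<dots> = (p - q) / 4"
    using q_pos by simp
  finally have x: "\<bar>x\<bar> \<le> (p - q) / 4" .
  have "ln (2 * q) \<le> 2 * q - 1"
    using q_pos by (intro ln_le_minus_one) auto
  then show "0 \<le> - ln (2 * q) - s * mz p q z * (p - q)"
    using x abs_le_D1[OF x] p_plus_q q_less_p unfolding x_def[symmetric] by simp
  have x1: "-1 < x"
    using abs_le_D2[OF x] p_plus_q q_pos q_less_p by simp
  have "a_tilt s z = 1 / (2 * q * (1 + x))"
    unfolding a_tilt_def x_def m H_def[symmetric] using q_pos by (simp add: distrib_left mult.commute)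
  then have "ln (a_tilt s z) = - ln (2 * q) - ln (1 + x)"
    using x1 q_pos by (simp add: ln_div ln_mult)
  moreover have "ln (1 + x) \<le> x"
    using x1 by (rule ln_add_one_self_le_self2)
  ultimately show "- ln (2 * q) - s * mz p q z * (p - q) \<le> ln (a_tilt s z)"
    by (simp add: x_def)
qed

text \<open>Let T be \<open>lambda0 q * L * s * mz p q z * (p - q)\<close>. Visits to
  \<open>u\<close> contribute at least K - T, by \<open>lambda0_ln\<close> and
  \<open>K \<le> L\<close>; visits to the neighbour at least T (1 + \<epsilon>) (1 - \<epsilon>/4).
  The first-order terms cancel and a surplus T \<epsilon>/4 is left.\<close>

lemma tilt_product_upper:
  fixes \<epsilon> K L \<xi> \<xi>' :: real
  assumes z: "z \<noteq> 0" and \<epsilon>: "0 < \<epsilon>" "\<epsilon> \<le> 1" and s: "s = q * \<epsilon> / 10"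
    and K: "0 \<le> K" "K \<le> L"
    and \<xi>: "lambda0 q * K \<le> \<xi>" and \<xi>': "(1 + \<epsilon>) * mz p q z * lambda0 q * L \<le> \<xi>'"
  shows "K + mz p q z * lambda0 q * L * s * (p - q) * \<epsilon> / 4 \<le>
    \<xi> * ln (a_tilt s z) + \<xi>' * ln (b_tilt s z)"
proof -
  define m where "m = mz p q z"
  define l where "l = lambda0 q"
  define d where "d = p - q"
  have d: "0 < d" "1 - 2 * q = d"
    using q_less_p p_plus_q by (auto simp: d_def)
  have m: "0 < m"
    using h_pos q_pos z by (simp add: m_def mz_eq)
  have l: "0 < l" "l * - ln (2 * q) = 1"
    using lambda0_pos lambda0_ln by (auto simp: l_def)
  have "q * \<epsilon> \<le> q * 1" "0 < q * \<epsilon>"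
    using \<epsilon> q_pos by (auto intro!: mult_left_mono mult_pos_pos)
  then have s0: "0 < s" "\<bar>s\<bar> \<le> q / 2"
    using s q_pos by linarith+
  have A: "- ln (2 * q) - s * m * d \<le> ln (a_tilt s z)" "0 \<le> - ln (2 * q) - s * m * d"
    using ln_a_tilt[OF z s0(2)] by (auto simp: m_def d_def)
  have B: "d * s * (1 - \<epsilon> / 4) \<le> ln (b_tilt s z)"
    unfolding b_tilt_def d(2)[symmetric]
    by (rule ln_tilt_lower_up) (use q_pos q_less_half \<epsilon> s h_pos h_less_1 in \<open>auto simp: power_le_one\<close>)
  have dse: "0 \<le> d * s * (1 - \<epsilon> / 4)"
    using d s0 \<epsilon> by simp
  have L: "0 \<le> L" using K by simp
  have lK: "l * K * (s * m * d) \<le> l * L * (s * m * d)"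
    using l K s0 m d by (intro mult_right_mono mult_left_mono) auto
  have "l * K * (- ln (2 * q) - s * m * d) = (l * - ln (2 * q)) * K - l * K * (s * m * d)"
    by (simp add: algebra_simps)
  also have "\<dots> = K - l * K * (s * m * d)"
    unfolding l(2) by simp
  finally have "K - l * L * (s * m * d) \<le> l * K * (- ln (2 * q) - s * m * d)"
    using lK by simp
  also have "\<dots> \<le> \<xi> * ln (a_tilt s z)"
    using A \<xi> l K unfolding l_def[symmetric] by (intro mult_mono order_trans[OF _ \<xi>[folded l_def]]) auto
  finally have 1: "K - l * L * (s * m * d) \<le> \<xi> * ln (a_tilt s z)" .
  have c0: "0 \<le> (1 + \<epsilon>) * m * l * L"
    using \<epsilon> m l L by simp
  have "((1 + \<epsilon>) * m * l * L) * (d * s * (1 - \<epsilon> / 4)) \<le> \<xi>' * ln (b_tilt s z)"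
    using B dse \<xi>' c0 unfolding m_def l_def by (intro mult_mono) auto
  also have "((1 + \<epsilon>) * m * l * L) * (d * s * (1 - \<epsilon> / 4)) =
      (l * L * (s * m * d)) * ((1 + \<epsilon>) * (1 - \<epsilon> / 4))"
    by simp
  finally have 2: "(l * L * (s * m * d)) * ((1 + \<epsilon>) * (1 - \<epsilon> / 4)) \<le> \<xi>' * ln (b_tilt s z)" .
  have "\<epsilon> * \<epsilon> \<le> \<epsilon> * 1"
    using \<epsilon> by (intro mult_left_mono) auto
  moreover have "(1 + \<epsilon>) * (1 - \<epsilon> / 4) = 1 + 3 / 4 * \<epsilon> - \<epsilon> * \<epsilon> / 4"
    by (simp add: field_simps)
  ultimately have "1 + \<epsilon> / 4 \<le> (1 + \<epsilon>) * (1 - \<epsilon> / 4)"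
    using \<epsilon> by linarith
  then have "(l * L * (s * m * d)) * (1 + \<epsilon> / 4) \<le> (l * L * (s * m * d)) * ((1 + \<epsilon>) * (1 - \<epsilon> / 4))"
    using l L s0 m d by (intro mult_left_mono) auto
  moreover have "(l * L * (s * m * d)) * (1 + \<epsilon> / 4) = l * L * (s * m * d) + m * l * L * s * d * \<epsilon> / 4"
    by (simp add: distrib_left)
  ultimately show ?thesis
    using 1 2 unfolding m_def[symmetric] l_def[symmetric] d_def[symmetric] by linarith
qed

text \<open>The signs are exchanged: with T formed from \<open>t\<close>, visits to \<open>u\<close>
  contribute at least K + T (1 - \<epsilon>/4), where \<open>K\<close> must be nearly as large as
  \<open>L\<close>, and the neighbour costs at most T (1 - \<epsilon>) (1 + \<epsilon>/2).\<close>

lemma tilt_product_lower: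
  fixes \<epsilon> K L \<xi> \<xi>' :: real
  assumes z: "z \<noteq> 0" and \<epsilon>: "0 < \<epsilon>" "\<epsilon> \<le> 1" and t: "t = q * \<epsilon> / 10"
    and K: "0 \<le> L" "L * (1 - \<epsilon> / 4) \<le> K"
    and \<xi>: "lambda0 q * K \<le> \<xi>" and \<xi>': "0 \<le> \<xi>'" "\<xi>' \<le> (1 - \<epsilon>) * mz p q z * lambda0 q * L"
  shows "K + mz p q z * lambda0 q * L * t * (p - q) * \<epsilon> / 4 \<le>
    \<xi> * ln (a_tilt (- t) z) + \<xi>' * ln (b_tilt (- t) z)"
proof -
  define m where "m = mz p q z"
  define l where "l = lambda0 q"
  define d where "d = p - q"
  have d: "0 < d" "1 - 2 * q = d"
    using q_less_p p_plus_q by (auto simp: d_def)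
  have m: "0 < m"
    using h_pos q_pos z by (simp add: m_def mz_eq)
  have l: "0 < l" "l * - ln (2 * q) = 1"
    using lambda0_pos lambda0_ln by (auto simp: l_def)
  have "q * \<epsilon> \<le> q * 1" "0 < q * \<epsilon>"
    using \<epsilon> q_pos by (auto intro!: mult_left_mono mult_pos_pos)
  then have t0: "0 < t" "\<bar>- t\<bar> \<le> q / 2"
    using t q_pos by linarith+
  have A: "- ln (2 * q) + t * m * d \<le> ln (a_tilt (- t) z)" "0 \<le> - ln (2 * q) + t * m * d"
    using ln_a_tilt[OF z t0(2)] by (auto simp: m_def d_def)
  have B: "- (d * t * (1 + \<epsilon> / 2)) \<le> ln (b_tilt (- t) z)" "ln (b_tilt (- t) z) \<le> 0"
    using ln_tilt_lower_down[OF q_pos q_less_half \<epsilon> t, of "h ^ nat \<bar>z\<bar>"] h_pos h_less_1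
    by (simp_all only: b_tilt_def d(2)[symmetric]) (simp_all add: power_le_one)
  have K0: "0 \<le> K"
    using K \<epsilon> order_trans[of 0 "L * (1 - \<epsilon> / 4)" K] by simp
  have lK: "l * (L * (1 - \<epsilon> / 4)) * (t * m * d) \<le> l * K * (t * m * d)"
    using l K t0 m d by (intro mult_right_mono mult_left_mono) auto
  have "l * K * (- ln (2 * q) + t * m * d) = (l * - ln (2 * q)) * K + l * K * (t * m * d)"
    by (simp add: algebra_simps)
  also have "\<dots> = K + l * K * (t * m * d)"
    unfolding l(2) by simp
  finally have "K + l * (L * (1 - \<epsilon> / 4)) * (t * m * d) \<le> l * K * (- ln (2 * q) + t * m * d)"
    using lK by simp
  also have "\<dots> \<le> \<xi> * ln (a_tilt (- t) z)"
    using A \<xi> l K0 unfolding l_def[symmetric] by (intro mult_mono order_trans[OF _ \<xi>[folded l_def]]) auto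
  finally have 1: "K + (l * L * (t * m * d)) * (1 - \<epsilon> / 4) \<le> \<xi> * ln (a_tilt (- t) z)"
    by (simp add: ac_simps)
  have "\<xi>' * (- ln (b_tilt (- t) z)) \<le> ((1 - \<epsilon>) * m * l * L) * (d * t * (1 + \<epsilon> / 2))"
    using B \<xi>' order_trans[OF \<xi>'] unfolding m_def l_def by (intro mult_mono) auto
  then have 2: "- ((l * L * (t * m * d)) * ((1 - \<epsilon>) * (1 + \<epsilon> / 2))) \<le> \<xi>' * ln (b_tilt (- t) z)"
    by (simp add: ac_simps)
  have "\<epsilon> / 4 \<le> (1 - \<epsilon> / 4) - (1 - \<epsilon>) * (1 + \<epsilon> / 2)"
    by (simp add: algebra_simps)
  then have "(l * L * (t * m * d)) * (\<epsilon> / 4) \<le>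
      (l * L * (t * m * d)) * ((1 - \<epsilon> / 4) - (1 - \<epsilon>) * (1 + \<epsilon> / 2))"
    using l K t0 m d by (intro mult_left_mono) auto
  moreover have "(l * L * (t * m * d)) * (\<epsilon> / 4) = m * l * L * t * d * \<epsilon> / 4"
    by simp
  ultimately show ?thesis
    using 1 2 unfolding m_def[symmetric] l_def[symmetric] d_def[symmetric] right_diff_distrib
    by linarith
qed

subsection \<open>Almost sure behaviour\<close>

text \<open>The tilt \<open>t\<close> controls a neighbour visited too often, \<open>- t\<close> one visited too rarely, and the
  tilt \<open>0\<close>, where \<open>b_tilt 0 z = 1\<close>, bounds the maximal local time itself.
\<close>

definition exceptional :: "real \<Rightarrow> real \<Rightarrow> real \<Rightarrow> real \<Rightarrow> nat \<Rightarrow> 'a set" where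
  "exceptional c \<beta> \<eta> t j = (\<Union>(u, z, s) \<in> {- (2 ^ j)..2 ^ j} \<times>
      {z. z \<noteq> 0 \<and> real_of_int \<bar>z\<bar> \<le> c * ln (real j * ln 2)} \<times> {t, - t, 0}.
    {\<omega> \<in> space M. \<exists>m\<le>2 ^ j. exp (real j * ln 2 - ln 2 + \<eta> * (real j * ln 2) powr \<beta>) \<le>
      a_tilt s z ^ local_time X u m \<omega> * b_tilt s z ^ local_time X (u + z) m \<omega>})"

text \<open>A window of width \<open>c * ln J\<close> is the one on which exponential decay in
  \<open>|z|\<close> amounts to a power of \<open>J\<close>.\<close>

lemma h_power_lower:
  assumes "real_of_int \<bar>z\<bar> \<le> c * ln J" "0 < J"
  shows "J powr (- (ln (1 / h) * c)) \<le> h ^ nat \<bar>z\<bar>"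
proof -
  have "J powr (- (ln (1 / h) * c)) = h powr (c * ln J)"
    using assms h_pos by (simp add: powr_def ln_div)
  also have "\<dots> \<le> h powr real (nat \<bar>z\<bar>)"
    using assms h_pos h_less_1 by (intro powr_mono') auto
  also have "\<dots> = h ^ nat \<bar>z\<bar>"
    by (rule powr_realpow[OF h_pos])
  finally show ?thesis .
qed

text \<open>In the union bound the factor \<open>2 ^ j\<close> of the threshold pays for the choices
  of \<open>u\<close>, and the inverse of \<open>h ^ nat \<bar>z\<bar>\<close> costs a power of
  \<open>j * ln 2\<close>. The stretched exponential survives.\<close>

lemma exceptional_bound:
  assumes "0 < c" "0 < \<eta>" "\<bar>t\<bar> \<le> q / 2" and j: "1 < real j * ln 2"
  shows "exceptional c \<beta> \<eta> t j \<in> events"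
    and "prob (exceptional c \<beta> \<eta> t j) \<le> 36 / q * ((2 * c * ln (real j * ln 2) + 1) *
      (real j * ln 2) powr (ln (1 / h) * c) * exp (- (\<eta> * (real j * ln 2) powr \<beta>)))"
proof -
  define J where "J = real j * ln 2"
  define Z where "Z = {z::int. z \<noteq> 0 \<and> real_of_int \<bar>z\<bar> \<le> c * ln J}"
  define I where "I = {- (2 ^ j)..2 ^ j :: int} \<times> Z \<times> {t, - t, 0}"
  define l where "l = exp (J - ln 2 + \<eta> * J powr \<beta>)"
  define E where "E = (\<lambda>(u, z, s). {\<omega> \<in> space M. \<exists>m\<le>2 ^ j. l \<le>
      a_tilt s z ^ local_time X u m \<omega> * b_tilt s z ^ local_time X (u + z) m \<omega>})"
  have eq: "exceptional c \<beta> \<eta> t j = (\<Union>i\<in>I. E i)"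
    unfolding exceptional_def I_def E_def Z_def l_def J_def by (auto split: prod.splits)
  have J: "1 < J"
    using j by (simp add: J_def)
  have ln2: "ln (2::real) < 1"
    using ln_2_less_1 .
  have "0 < J - ln 2 + \<eta> * J powr \<beta>"
    using J ln2 assms by (intro add_pos_nonneg) auto
  then have l: "1 < l"
    by (simp add: l_def)
  have lJ: "0 < c * ln J"
    using J assms by simp
  have fin: "finite I" and cardZ: "real (card Z) \<le> 2 * c * ln J + 1"
    using finite_abs_le card_abs_le[of "c * ln J"] lJ by (auto simp: I_def Z_def)
  have ev: "E i \<in> events" and pr: "prob (E i) \<le> 2 / (q * J powr (- (ln (1 / h) * c)) * l)" if "i \<in> I" for i
  proof -
    obtain u z s where i: "i = (u, z, s)"
      by (cases i) auto
    with that have *: "z \<noteq> 0" "real_of_int \<bar>z\<bar> \<le> c * ln J" "\<bar>s\<bar> \<le> q / 2"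
      using assms q_pos by (auto simp: I_def Z_def)
    have "prob (E i) \<le> 2 / (q * h ^ nat \<bar>z\<bar> * l)"
      unfolding E_def i prod.case by (rule two_point_bound(2)[OF *(1,3) l])
    also have "\<dots> \<le> 2 / (q * J powr (- (ln (1 / h) * c)) * l)"
      using q_pos l J h_pos h_power_lower[OF *(2)]
      by (intro divide_left_mono mult_right_mono mult_left_mono) auto
    finally show "prob (E i) \<le> 2 / (q * J powr (- (ln (1 / h) * c)) * l)" .
    show "E i \<in> events"
      unfolding E_def i prod.case by (rule two_point_bound(1)[OF *(1,3) l])
  qed
  show "exceptional c \<beta> \<eta> t j \<in> events"
    unfolding eq by (intro sets.finite_UN fin ev)
  have "prob (exceptional c \<beta> \<eta> t j) \<le> (\<Sum>i\<in>I. prob (E i))"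
    unfolding eq by (intro measure_UNION_le fin ev)
  also have "\<dots> \<le> real (card I) * (2 / (q * J powr (- (ln (1 / h) * c)) * l))"
    by (intro sum_bounded_above pr)
  also have "\<dots> \<le> (3 * 2 ^ j * ((2 * c * ln J + 1) * 3)) * (2 / (q * J powr (- (ln (1 / h) * c)) * l))"
  proof (intro mult_right_mono)
    have "real (card {t, - t, 0}) \<le> 3"
      using card_insert_le_m1[of 3 "{- t, 0}" t] card_insert_le_m1[of 2 "{0}" "- t"] by simp
    moreover have "real (card {- (2 ^ j)..2 ^ j :: int}) \<le> 3 * 2 ^ j"
    proof -
      have "real (card {- (2 ^ j)..2 ^ j :: int}) = 2 * 2 ^ j + 1"
        by (simp add: of_nat_nat)
      also have "\<dots> \<le> 3 * 2 ^ j"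
        using one_le_power[of "2::real" j] by simp
      finally show ?thesis .
    qed
    ultimately show "real (card I) \<le> 3 * 2 ^ j * ((2 * c * ln J + 1) * 3)"
      unfolding I_def card_cartesian_product of_nat_mult using cardZ by (intro mult_mono) auto
  qed (use q_pos l in auto)
  \<comment> \<open>36 is 3 from the count of \<open>u\<close>, 3 for the tilts, 2 from the
    two-point bound and 2 from the \<open>- ln 2\<close> in the threshold.\<close>
  also have "\<dots> = 36 / q * ((2 * c * ln J + 1) * J powr (ln (1 / h) * c) * exp (- (\<eta> * J powr \<beta>)))"
  proof -
    have l: "l = 2 ^ j / 2 * exp (\<eta> * J powr \<beta>)"
      by (simp add: l_def exp_add exp_diff J_def exp_of_nat_mult)
    have *: "(3 * T * (P * 3)) * (2 / (q * inverse G * (T / 2 * e))) = 36 / q * (P * G * inverse e)"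
      if "T \<noteq> 0" "G \<noteq> 0" "e \<noteq> 0" for T P G e :: real
      using that q_pos by (simp add: field_simps)
    show ?thesis
      unfolding l powr_minus exp_minus by (rule *) (use J in auto)
  qed
  finally show "prob (exceptional c \<beta> \<eta> t j) \<le> 36 / q * ((2 * c * ln (real j * ln 2) + 1) *
      (real j * ln 2) powr (ln (1 / h) * c) * exp (- (\<eta> * (real j * ln 2) powr \<beta>)))"
    by (simp add: J_def)
qed

lemma AE_not_exceptional:
  assumes "0 < c" "0 < \<eta>" "0 < \<beta>" "\<bar>t\<bar> \<le> q / 2"
  shows "AE \<omega> in M. eventually (\<lambda>j. \<omega> \<notin> exceptional c \<beta> \<eta> t j) sequentially"
proof -
  \<comment> \<open>Small \<open>j\<close> are discarded, since the bound requires
    \<open>1 < j * ln 2\<close>.\<close>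
  define A where "A j = (if 1 < real j * ln 2 then exceptional c \<beta> \<eta> t j else {})" for j
  have ev: "eventually (\<lambda>j. 1 < real j * ln 2) sequentially"
    by real_asymp
  have "AE \<omega> in M. eventually (\<lambda>j. \<omega> \<in> space M - A j) sequentially"
  proof (rule borel_cantelli_AE1)
    show "summable (\<lambda>j. prob (A j))"
    proof (rule summable_comparison_test_ev)
      show "summable (\<lambda>j. 36 / q * ((2 * c * ln (real j * ln 2) + 1) *
          (real j * ln 2) powr (ln (1 / h) * c) * exp (- (\<eta> * (real j * ln 2) powr \<beta>))))"
        using assms by (intro summable_mult summable_stretched_exponential) auto
      show "eventually (\<lambda>j. norm (prob (A j)) \<le> 36 / q * ((2 * c * ln (real j * ln 2) + 1) *
          (real j * ln 2) powr (ln (1 / h) * c) * exp (- (\<eta> * (real j * ln 2) powr \<beta>)))) sequentially"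
        using ev by eventually_elim (use exceptional_bound(2)[OF assms(1,2,4)] in \<open>simp add: A_def\<close>)
    qed
  qed (use exceptional_bound(1)[OF assms(1,2,4)] in \<open>auto simp: A_def less_top[symmetric]\<close>)
  then show ?thesis
  proof eventually_elim
    case (elim \<omega>)
    with ev show ?case
      by eventually_elim (simp add: A_def)
  qed
qed

text \<open>The event covers all times up to \<open>2 ^ j\<close>, so one scale serves every
  \<open>n\<close> below it; it remains to take logarithms.\<close>

lemma not_exceptionalD:
  assumes "\<omega> \<notin> exceptional c \<beta> \<eta> t j" "\<omega> \<in> space M" "\<bar>t\<bar> \<le> q / 2"
    and "\<bar>u\<bar> \<le> 2 ^ j" "z \<noteq> 0" "real_of_int \<bar>z\<bar> \<le> c * ln (real j * ln 2)" "s \<in> {t, - t, 0}" "n \<le> 2 ^ j"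
  shows "real (local_time X u n \<omega>) * ln (a_tilt s z) + real (local_time X (u + z) n \<omega>) * ln (b_tilt s z) <
    real j * ln 2 - ln 2 + \<eta> * (real j * ln 2) powr \<beta>"
proof -
  have s: "\<bar>s\<bar> \<le> q / 2"
    using assms q_pos by auto
  have "(u, z, s) \<in> {- (2 ^ j)..2 ^ j} \<times> {z. z \<noteq> 0 \<and> real_of_int \<bar>z\<bar> \<le> c * ln (real j * ln 2)} \<times> {t, - t, 0}"
    using assms by auto
  with assms have "\<not> exp (real j * ln 2 - ln 2 + \<eta> * (real j * ln 2) powr \<beta>) \<le>
      a_tilt s z ^ local_time X u n \<omega> * b_tilt s z ^ local_time X (u + z) n \<omega>"
    unfolding exceptional_def by blast
  moreover have "a_tilt s z ^ local_time X u n \<omega> * b_tilt s z ^ local_time X (u + z) n \<omega> =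
      exp (real (local_time X u n \<omega>) * ln (a_tilt s z) + real (local_time X (u + z) n \<omega>) * ln (b_tilt s z))"
    using tilt_pos[OF s] by (simp add: exp_add exp_of_nat_mult)
  ultimately show ?thesis
    by simp
qed

lemma tilt_zero: "ln (a_tilt 0 z) = - ln (2 * q)" "b_tilt 0 z = 1"
  using q_pos by (auto simp: a_tilt_def b_tilt_def ln_div)

text \<open>
  Here \<open>J\<close> is the logarithm of the dyadic number \<open>2 ^ j\<close> next above \<open>n\<close>.
\<close>

lemma local_time_near_max:
  fixes \<epsilon> c J \<eta> \<beta> :: real and j :: nat
  assumes \<epsilon>: "0 < \<epsilon>" "\<epsilon> \<le> 1" and c: "0 < c"
    and t_def: "t = q * \<epsilon> / 10"
    and \<eta>_def: "\<eta> = lambda0 q * t * (p - q) * \<epsilon> / 16"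
    and \<beta>_def: "\<beta> = 1 - ln (1 / h) * c"
    and J_def: "J = real j * ln 2"
    and J1: "2 \<le> J" "1 \<le> c * ln J" "J * (1 - \<epsilon> / 4) \<le> J - ln 2 - \<eta> * J powr \<beta>"
      "J - ln 2 + \<eta> * J powr \<beta> \<le> (1 + \<epsilon>) * (J - ln 2)"
    and n: "n \<le> 2 ^ j" "ln (real n) \<le> J" "J \<le> ln (real n) + ln 2"
    and \<omega>: "\<omega> \<notin> exceptional c \<beta> \<eta> t j" "\<omega> \<in> space M" "\<forall>i\<ge>1. X i \<omega> = 1 \<or> X i \<omega> = -1"
    and \<delta>: "\<delta> \<le> \<epsilon>" "\<delta> * ln (real n) \<le> \<eta> * J powr \<beta>"
    and u: "(1 - \<delta>) * lambda0 q * ln (real n) \<le> real (local_time X u n \<omega>)"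
    and z: "real_of_int \<bar>z\<bar> \<le> c * ln (ln (real n))"
  shows "\<bar>real (local_time X (u + z) n \<omega>) / (mz p q z * lambda0 q * ln (real n)) - 1\<bar> \<le> \<epsilon>"
proof -
  define l where "l = lambda0 q"
  define \<xi> where "\<xi> = real (local_time X u n \<omega>)"
  define \<xi>' where "\<xi>' = real (local_time X (u + z) n \<omega>)"
  \<comment> \<open>\<open>l * K\<close> will bound \<open>\<xi>\<close> from below: passing from
    \<open>J\<close> to \<open>ln n\<close> loses at most \<open>ln 2\<close>, and
    \<open>\<eta> * J powr \<beta>\<close> dominates \<open>\<delta> * ln n\<close>.\<close>
  define K where "K = J - ln 2 - \<eta> * J powr \<beta>"
  have l: "0 < l" "l * - ln (2 * q) = 1"
    using lambda0_pos lambda0_ln by (auto simp: l_def)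
  have d: "0 < p - q"
    using q_less_p by simp
  have "q * \<epsilon> \<le> q * 1" "0 < q * \<epsilon>"
    using \<epsilon> q_pos by (auto intro!: mult_left_mono mult_pos_pos)
  then have t: "0 < t" "\<bar>t\<bar> \<le> q / 2"
    using t_def q_pos by linarith+
  have \<eta>: "0 < \<eta>"
    unfolding \<eta>_def using lambda0_pos t d \<epsilon> by simp
  have ln2: "0 < ln (2::real)" "ln (2::real) < 1"
    using ln_2_less_1 by auto
  have lnn: "1 < ln (real n)"
    using J1(1) n(3) ln2 by linarith
  have K0: "0 < K"
  proof -
    have "0 < J * (1 - \<epsilon> / 4)"
      using J1 \<epsilon> by simp
    then show ?thesis
      using J1(3) by (simp add: K_def)
  qed
  have "l * K \<le> l * ((1 - \<delta>) * ln (real n))"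
    using \<delta>(2) n(3) l by (intro mult_left_mono) (auto simp: K_def algebra_simps)
  then have \<xi>: "l * K \<le> \<xi>"
    using u by (simp add: \<xi>_def l_def ac_simps)
  \<comment> \<open>So \<open>u\<close> has been visited and lies in the range covered by the
    exceptional event.\<close>
  with l K0 have "0 < \<xi>"
    using mult_pos_pos[of l K] by linarith
  then have "\<bar>u\<bar> \<le> int n"
    using abs_le_of_local_time_pos[where X = X and \<omega> = \<omega>, OF \<omega>(3), of u n] by (simp add: \<xi>_def)
  also have "int n \<le> 2 ^ j"
    using of_nat_mono[OF n(1), where ?'a = int] by simp
  finally have u_le: "\<bar>u\<bar> \<le> 2 ^ j" .
  have lnJ: "ln (ln (real n)) \<le> ln J"
    using lnn n(2) by simp
  have m: "0 < mz p q z"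
    using h_pos q_pos mz_eq[of z] by (cases "z = 0") (auto simp: mz_def)
  have main: "(1 - \<epsilon>) * mz p q z * l * ln (real n) \<le> \<xi>' \<and> \<xi>' \<le> (1 + \<epsilon>) * mz p q z * l * ln (real n)"
  proof (cases "z = 0")
    case True
    have "(1 - \<epsilon>) * (l * ln (real n)) \<le> (1 - \<delta>) * (l * ln (real n))"
      using \<delta>(1) l lnn by (intro mult_right_mono) auto
    also have "\<dots> \<le> \<xi>'"
      using u True by (simp add: \<xi>'_def l_def ac_simps)
    finally have lo: "(1 - \<epsilon>) * (l * ln (real n)) \<le> \<xi>'" .
    have "\<xi> * - ln (2 * q) < J - ln 2 + \<eta> * J powr \<beta>"
      using not_exceptionalD[OF \<omega>(1,2) t(2) u_le, of 1 0 n] J1(2) n(1)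
      unfolding tilt_zero J_def \<xi>_def by simp
    also have "\<dots> \<le> (1 + \<epsilon>) * (J - ln 2)"
      by (rule J1(4))
    also have "\<dots> \<le> (1 + \<epsilon>) * ln (real n)"
      using n(3) \<epsilon> by (intro mult_left_mono) auto
    finally have "l * (\<xi> * - ln (2 * q)) \<le> l * ((1 + \<epsilon>) * ln (real n))"
      using l by (intro mult_left_mono) auto
    moreover have "l * (\<xi> * - ln (2 * q)) = (l * - ln (2 * q)) * \<xi>"
      by simp
    ultimately have "\<xi> \<le> l * ((1 + \<epsilon>) * ln (real n))"
      unfolding l(2) by simp
    then show ?thesis
      using lo True by (simp add: \<xi>_def \<xi>'_def mz_def ac_simps)
  next
    case False
    have zJ: "real_of_int \<bar>z\<bar> \<le> c * ln J"
      using z mult_left_mono[OF lnJ, of c] c by linarith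
    have "J powr \<beta> = J * J powr (- (ln (1 / h) * c))"
      using J1(1) by (simp add: \<beta>_def powr_diff powr_minus field_simps)
    also have "\<dots> \<le> J * h ^ nat \<bar>z\<bar>"
      using h_power_lower[OF zJ] J1(1) by (intro mult_left_mono) auto
    also have "\<dots> \<le> J * mz p q z"
    proof (intro mult_left_mono)
      show "h ^ nat \<bar>z\<bar> \<le> mz p q z"
        using h_pos q_pos q_less_half unfolding mz_eq[OF False] by (simp add: field_simps)
    qed (use J1 in auto)
    finally have Jm: "J powr \<beta> \<le> J * mz p q z" .
    \<comment> \<open>The 16 in \<open>\<eta>\<close> makes the surplus at least twice
      \<open>\<eta> * J powr \<beta>\<close>: one half makes up for the loss in \<open>K\<close>,
      the other reaches the threshold.\<close>
    have gain: "2 * \<eta> * J powr \<beta> \<le> mz p q z * l * L * t * (p - q) * \<epsilon> / 4" if "J / 2 \<le> L" for L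
    proof -
      have "J powr \<beta> \<le> 2 * L * mz p q z"
        using Jm mult_right_mono[OF that, of "mz p q z"] m by linarith
      then have "2 * \<eta> * J powr \<beta> \<le> 2 * \<eta> * (2 * L * mz p q z)"
        using \<eta> by (intro mult_left_mono) auto
      then show ?thesis
        by (simp add: \<eta>_def l_def field_simps)
    qed
    have no: "\<xi> * ln (a_tilt s z) + \<xi>' * ln (b_tilt s z) < J - ln 2 + \<eta> * J powr \<beta>" if "s \<in> {t, - t, 0}" for s
      using not_exceptionalD[OF \<omega>(1,2) t(2) u_le False zJ[unfolded J_def] that n(1)]
      by (simp add: \<xi>_def \<xi>'_def J_def)
    have \<eta>J: "0 \<le> \<eta> * J powr \<beta>"
      using \<eta> by simp
    \<comment> \<open>\<open>L\<close> is the end of the interval from \<open>J - ln 2\<close> to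
      \<open>J\<close> around \<open>ln n\<close> that gives the stronger claim: the left end here,
      the right end for the lower bound.\<close>
    have up: "\<xi>' < (1 + \<epsilon>) * mz p q z * l * (J - ln 2)"
    proof (rule ccontr)
      assume "\<not> ?thesis"
      then have "K + mz p q z * l * (J - ln 2) * t * (p - q) * \<epsilon> / 4 \<le>
          \<xi> * ln (a_tilt t z) + \<xi>' * ln (b_tilt t z)"
        using False \<epsilon> t_def K0 \<xi> \<eta>J unfolding l_def by (intro tilt_product_upper) (auto simp: K_def)
      moreover have "2 * \<eta> * J powr \<beta> \<le> mz p q z * l * (J - ln 2) * t * (p - q) * \<epsilon> / 4"
        using J1(1) ln2 by (intro gain) auto
      ultimately show False
        using no[of t] by (simp add: K_def)
    qed
    have down: "(1 - \<epsilon>) * mz p q z * l * J < \<xi>'"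
    proof (rule ccontr)
      assume "\<not> ?thesis"
      then have "K + mz p q z * l * J * t * (p - q) * \<epsilon> / 4 \<le>
          \<xi> * ln (a_tilt (- t) z) + \<xi>' * ln (b_tilt (- t) z)"
        using False \<epsilon> t_def J1 \<xi> unfolding l_def by (intro tilt_product_lower) (auto simp: K_def \<xi>'_def)
      moreover have "2 * \<eta> * J powr \<beta> \<le> mz p q z * l * J * t * (p - q) * \<epsilon> / 4"
        using J1(1) by (intro gain) auto
      ultimately show False
        using no[of "- t"] by (simp add: K_def)
    qed
    have "(1 - \<epsilon>) * mz p q z * l * ln (real n) \<le> (1 - \<epsilon>) * mz p q z * l * J"
      using \<epsilon> m l n(2) by (intro mult_left_mono) auto
    moreover have "(1 + \<epsilon>) * mz p q z * l * (J - ln 2) \<le> (1 + \<epsilon>) * mz p q z * l * ln (real n)"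
      using \<epsilon> m l n(3) by (intro mult_left_mono) auto
    ultimately show ?thesis
      using up down by linarith
  qed
  define D where "D = mz p q z * l * ln (real n)"
  have D: "0 < D"
    unfolding D_def using m l lnn by simp
  have "(1 - \<epsilon>) * D \<le> \<xi>'" "\<xi>' \<le> (1 + \<epsilon>) * D"
    using main by (simp_all add: D_def ac_simps)
  then have "1 - \<epsilon> \<le> \<xi>' / D" "\<xi>' / D \<le> 1 + \<epsilon>"
    using D by (simp_all add: pos_le_divide_eq pos_divide_le_eq)
  then show ?thesis
    unfolding \<xi>'_def[symmetric] l_def[symmetric] D_def[symmetric] by (simp add: abs_le_iff)
qed

text \<open>With \<open>\<beta> = 1 - ln (1 / h) * c\<close> the hypothesis on
  \<open>\<delta>\<close> says that \<open>\<delta> n * ln n\<close> is eventually below any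
  positive multiple of \<open>ln n powr \<beta>\<close>, the order of the surplus of the tilted
  product.\<close>

lemma local_time_near_max_AE:
  fixes \<delta> :: "nat \<Rightarrow> real"
  assumes \<epsilon>: "0 < \<epsilon>" "\<epsilon> \<le> 1" and c: "0 < c" "ln (1 / h) * c < 1"
    and \<delta>: "(\<lambda>n. \<delta> n * ln (real n) powr (ln (1 / h) * c)) \<longlonglongrightarrow> 0"
  shows "AE \<omega> in M. eventually (\<lambda>n.
      \<forall>u::int. real (local_time X u n \<omega>) \<ge> (1 - \<delta> n) * lambda0 q * ln (real n) \<longrightarrow>
        (\<forall>z::int. real_of_int \<bar>z\<bar> \<le> c * ln (ln (real n)) \<longrightarrow>
          \<bar>real (local_time X (u + z) n \<omega>) / (mz p q z * lambda0 q * ln (real n)) - 1\<bar> \<le> \<epsilon>))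
    sequentially"
proof -
  define t where "t = q * \<epsilon> / 10"
  define \<eta> where "\<eta> = lambda0 q * t * (p - q) * \<epsilon> / 16"
  define \<gamma> where "\<gamma> = ln (1 / h) * c"
  define \<beta> where "\<beta> = 1 - ln (1 / h) * c"
  define J where "J j = real j * ln 2" for j :: nat
  define j where "j n = nat \<lceil>log 2 (real n)\<rceil>" for n :: nat
  have "q * \<epsilon> \<le> q * 1" "0 < q * \<epsilon>"
    using \<epsilon> q_pos by (auto intro!: mult_left_mono mult_pos_pos)
  then have t: "0 < t" "\<bar>t\<bar> \<le> q / 2"
    using t_def q_pos by linarith+
  have \<eta>: "0 < \<eta>"
    unfolding \<eta>_def using lambda0_pos t q_less_p \<epsilon> by simp
  have \<gamma>: "0 < \<gamma>"
    unfolding \<gamma>_def using h_pos h_less_1 c by (intro mult_pos_pos) (auto simp: ln_gt_zero)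
  have \<beta>: "0 < \<beta>" "\<beta> < 1" "\<beta> = 1 - \<gamma>"
    using c \<gamma> by (auto simp: \<beta>_def \<gamma>_def)
  have j_lim: "filterlim j at_top at_top"
    unfolding j_def by real_asymp
  have J_lim: "filterlim J at_top at_top"
    unfolding J_def by real_asymp
  \<comment> \<open>As \<open>\<beta> < 1\<close>, the term \<open>\<eta> * x powr \<beta>\<close>
    is negligible against \<open>x\<close>.\<close>
  have large: "eventually (\<lambda>x::real. 2 \<le> x \<and> 1 \<le> c * ln x \<and> x * (1 - \<epsilon> / 4) \<le> x - ln 2 - \<eta> * x powr \<beta> \<and>
      x - ln 2 + \<eta> * x powr \<beta> \<le> (1 + \<epsilon>) * (x - ln 2)) at_top"
    using \<beta> \<epsilon> c(1) by (intro eventually_conj; real_asymp)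
  have large_n: "eventually (\<lambda>n. 2 \<le> J (j n) \<and> 1 \<le> c * ln (J (j n)) \<and>
      J (j n) * (1 - \<epsilon> / 4) \<le> J (j n) - ln 2 - \<eta> * J (j n) powr \<beta> \<and>
      J (j n) - ln 2 + \<eta> * J (j n) powr \<beta> \<le> (1 + \<epsilon>) * (J (j n) - ln 2)) sequentially"
    using eventually_compose_filterlim[OF large filterlim_compose[OF J_lim j_lim]] by simp
  have delta_n: "eventually (\<lambda>n. \<delta> n \<le> \<epsilon> \<and> \<delta> n * ln (real n) \<le> \<eta> * ln (real n) powr \<beta>) sequentially"
  proof -
    have "eventually (\<lambda>n. \<delta> n * ln (real n) powr \<gamma> < min \<epsilon> \<eta>) sequentially"
      using order_tendstoD(2)[OF \<delta>, of "min \<epsilon> \<eta>"] \<epsilon> \<eta> by (simp add: \<gamma>_def)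
    moreover have "eventually (\<lambda>n. 1 \<le> ln (real n)) sequentially"
      by real_asymp
    ultimately show ?thesis
    proof eventually_elim
      case (elim n)
      define x where "x = ln (real n)"
      have x: "1 \<le> x" "1 \<le> x powr \<gamma>" "\<delta> n * x powr \<gamma> < \<epsilon>" "\<delta> n * x powr \<gamma> < \<eta>"
        using elim \<gamma> by (auto simp: x_def ge_one_powr_ge_zero)
      have "\<delta> n \<le> \<epsilon>"
      \<comment> \<open>\<open>\<delta> n\<close> may be negative, and then dropping the factor
        \<open>x powr \<gamma>\<close> would go the wrong way.\<close>
      proof (cases "0 \<le> \<delta> n")
        case True
        then have "\<delta> n * 1 \<le> \<delta> n * x powr \<gamma>"
          using x by (intro mult_left_mono) auto
        then show ?thesis using x by simp
      qed (use \<epsilon> in auto)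
      moreover have "\<delta> n * x = \<delta> n * x powr \<gamma> * x powr \<beta>"
        using x \<beta> by (simp add: powr_diff)
      moreover have "\<delta> n * x powr \<gamma> * x powr \<beta> \<le> \<eta> * x powr \<beta>"
        using x by (intro mult_right_mono) auto
      ultimately show ?case
        unfolding x_def[symmetric] by linarith
    qed
  qed
  have ev2: "eventually (\<lambda>n::nat. 2 \<le> n) sequentially"
    by (rule eventually_ge_at_top)
  have "AE \<omega> in M. eventually (\<lambda>j. \<omega> \<notin> exceptional c \<beta> \<eta> t j) sequentially"
    using c \<eta> \<beta> t by (intro AE_not_exceptional) auto
  then show ?thesis
    using AE_X_step AE_space
  proof eventually_elim
    case (elim \<omega>)
    have "eventually (\<lambda>n. \<omega> \<notin> exceptional c \<beta> \<eta> t (j n)) sequentially"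
      using eventually_compose_filterlim[OF elim(1) j_lim] .
    then show ?case
      using large_n delta_n ev2
    proof eventually_elim
      case (elim n)
      note jn = le_two_power_ceiling_log[OF elim(4), folded j_def, folded J_def]
      have "0 \<le> ln (real n)"
        using elim(4) by simp
      then have "ln (real n) powr \<beta> \<le> J (j n) powr \<beta>"
        using jn(2) \<beta> by (intro powr_mono2) auto
      then have "\<eta> * ln (real n) powr \<beta> \<le> \<eta> * J (j n) powr \<beta>"
        using \<eta> by (intro mult_left_mono) auto
      then have \<delta>_le: "\<delta> n * ln (real n) \<le> \<eta> * J (j n) powr \<beta>"
        using elim(3) by linarith
      show ?case
        using local_time_near_max[OF \<epsilon> c(1) t_def \<eta>_def \<beta>_def, of "J (j n)" "j n" n \<omega> "\<delta> n"]
          elim jn \<delta>_le \<open>\<omega> \<in> space M\<close> \<open>\<forall>i\<ge>1. X i \<omega> = 1 \<or> X i \<omega> = -1\<close>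
        by (simp add: J_def)
    qed
  qed
qed

end

theorem theorem3p5:
  fixes M :: "'a measure" and X :: "nat \<Rightarrow> 'a \<Rightarrow> int"
    and p q c :: real and \<delta> :: "nat \<Rightarrow> real"
  assumes "prob_space M"
    and "0 < q" "q < p" "p < 1" "p + q = 1"
    and "\<forall>i\<ge>1. X i \<in> measurable M (count_space UNIV)"
    and "prob_space.indep_vars M (\<lambda>_. count_space UNIV) X {1..}"
    and "\<forall>i\<ge>1. measure M {\<omega> \<in> space M. X i \<omega> = 1} = p"
    and "\<forall>i\<ge>1. measure M {\<omega> \<in> space M. X i \<omega> = -1} = q"
    and "c > 0" and "ln (1 / (q / p)) * c < 1"
    and "(\<lambda>n. \<delta> n * ln (real n) powr (ln (1 / (q / p)) * c)) \<longlonglongrightarrow> 0"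
  shows "AE \<omega> in M. \<forall>\<epsilon>>0. eventually (\<lambda>n.
           \<forall>u::int. real (local_time X u n \<omega>) \<ge> (1 - \<delta> n) * lambda0 q * ln (real n) \<longrightarrow>
             (\<forall>z::int. real_of_int \<bar>z\<bar> \<le> c * ln (ln (real n)) \<longrightarrow>
                \<bar>real (local_time X (u + z) n \<omega>) / (mz p q z * lambda0 q * ln (real n)) - 1\<bar> \<le> \<epsilon>))
         sequentially"
proof -
  interpret prob_space M
    by fact
  interpret biased_walk M X p q
    using assms by unfold_locales auto
  \<comment> \<open>The claim is monotone in \<open>\<epsilon>\<close>, so the countably many values
    \<open>1 / Suc k\<close> suffice and their null sets unite into one.\<close>
  have "AE \<omega> in M. \<forall>k. eventually (\<lambda>n.
      \<forall>u::int. real (local_time X u n \<omega>) \<ge> (1 - \<delta> n) * lambda0 q * ln (real n) \<longrightarrow>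
        (\<forall>z::int. real_of_int \<bar>z\<bar> \<le> c * ln (ln (real n)) \<longrightarrow>
          \<bar>real (local_time X (u + z) n \<omega>) / (mz p q z * lambda0 q * ln (real n)) - 1\<bar> \<le> 1 / real (Suc k)))
    sequentially"
    using assms(10-12) by (intro AE_all_countable[THEN iffD2] allI local_time_near_max_AE) (auto simp: h_def)
  then show ?thesis
  proof eventually_elim
    case (elim \<omega>)
    show ?case
    proof (intro allI impI)
      fix \<epsilon> :: real
      assume "0 < \<epsilon>"
      then obtain k where k: "1 / real (Suc k) < \<epsilon>"
        using nat_approx_posE by blast
      show "eventually (\<lambda>n.
          \<forall>u::int. real (local_time X u n \<omega>) \<ge> (1 - \<delta> n) * lambda0 q * ln (real n) \<longrightarrow>
            (\<forall>z::int. real_of_int \<bar>z\<bar> \<le> c * ln (ln (real n)) \<longrightarrow>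
              \<bar>real (local_time X (u + z) n \<omega>) / (mz p q z * lambda0 q * ln (real n)) - 1\<bar> \<le> \<epsilon>))
          sequentially"
        using elim[rule_format, of k] by eventually_elim (use k in force)
    qed
  qed
qed

end
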